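(* Let $r\in\mathbb{R}$ with $0<|r|<1$. Then $\{\mathcal{T}_r(x)\mid x\in\mathbb{Z}\}$ is a tiling of $\mathbb{R}$ by (possibly degenerate) intervals, in the following sense: each $\mathcal{T}_r(x)$, $x\in\mathbb{Z}$, is a (possibly degenerate) interval, $\bigcup_{x\in\mathbb{Z}}\mathcal{T}_r(x)=\mathbb{R}$, and $\#\big(\mathcal{T}_r(x)\cap\mathcal{T}_r(x')\big)\le1$ for all $x,x'\in\mathbb{Z}$ with $x\ne x'$.
   Context: For $r\in\mathbb{R}$ with $0<|r|<1$ let $\tau_r:\mathbb{Z}\to\mathbb{Z}$, $\tau_r(z)=-\lfloor rz\rfloor$, and $\tau_r^{-n}(x)=\{z\in\mathbb{Z}\mid\tau_r^n(z)=x\}$. The (one-dimensional) SRS tile of $x\in\mathbb{Z}$ is $\mathcal{T}_r(x)=\mathrm{Li}_{n\to\infty}(-r)^n\tau_r^{-n}(x)\subset\mathbb{R}$, where the lower Hausdorff limit $\mathrm{Li}_{n\to\infty}A_n$ of subsets $A_n\subseteq\mathbb{R}$ is the set of all $t\in\mathbb{R}$ such that each neighbourhood of $t$ intersects $A_n$ for all sufficiently large $n$. A degenerate interval is a single point. *)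

theory Defs
  imports "HOL-Analysis.Analysis"
begin

definition srs_map :: "real \<Rightarrow> int \<Rightarrow> int" where
  "srs_map r z = - \<lfloor>r * of_int z\<rfloor>"

definition lower_hausdorff_limit :: "(nat \<Rightarrow> real set) \<Rightarrow> real set" where
  "lower_hausdorff_limit A =
     {t. \<forall>U. open U \<and> t \<in> U \<longrightarrow> (\<forall>\<^sub>F n in sequentially. U \<inter> A n \<noteq> {})}"

definition srs_tile :: "real \<Rightarrow> int \<Rightarrow> real set" where
  "srs_tile r x =
     lower_hausdorff_limit (\<lambda>n. (\<lambda>z. (- r) ^ n * of_int z) ` ((srs_map r ^^ n) -` {x}))"

end

theory Submission
  imports Defs
begin

text \<open>Write $\tau = \tau_r$ and $A_n(x) = (-r)^n \tau^{-n}(x)$. Since $\tau$ differs from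
  multiplication by $-r$ by less than 1, $(-r)^k w$ stays within $1/(1-|r|)$ of $\tau^k(w)$; as
  $\tau$ is onto, every point of $A_n(x)$ is therefore within $|r|^n/(1-|r|)$ of each later set
  $A_m(x)$. Hence points that approach $t$ at rate $|r|^n$ along infinitely many $n$ already put
  $t$ in the tile, which gives nonemptiness and (by pigeonhole on $\tau^n$ of the integer closest
  to $t/(-r)^n$) the covering property. Moreover $\tau$ is monotone or antitone, so $\tau^{-n}(x)$
  is a set of consecutive integers: between two points of the tile of $x$, all multiples of
  $(-r)^n$ eventually belong to $A_n(x)$. This makes tiles intervals, and it forbids two common
  points of distinct tiles because $A_n(x)$ and $A_n(x')$ are disjoint.\<close>

section \<open>Monotonicity of the iterates and convexity of their fibres\<close>

lemma mono_or_antimono_srs_map: "mono (srs_map r) \<or> antimono (srs_map r)"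
proof (cases "0 \<le> r")
  case True
  then have "antimono (srs_map r)"
    by (intro antimonoI) (simp add: srs_map_def floor_mono mult_left_mono)
  then show ?thesis ..
next
  case False
  then have "mono (srs_map r)"
    by (intro monoI) (simp add: srs_map_def floor_mono mult_left_mono_neg)
  then show ?thesis ..
qed

text \<open>Two antitone maps compose to a monotone one, so for antitone \<open>f\<close> the
  direction alternates with the parity of \<open>n\<close>; the disjunction is the form that
  survives the induction.\<close>

lemma mono_or_antimono_funpow:
  fixes f :: "'a::order \<Rightarrow> 'a"
  assumes "mono f \<or> antimono f"
  shows "mono (f ^^ n) \<or> antimono (f ^^ n)"
proof (induction n)
  case 0
  then show ?case by (simp add: mono_def)
next
  case (Suc n)
  then show ?case
    using assms by (elim disjE) (simp_all add: monotone_def)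
qed

lemma srs_map_funpow_between:
  assumes "(srs_map r ^^ n) a = x" "(srs_map r ^^ n) b = x" "a \<le> z" "z \<le> b"
  shows "(srs_map r ^^ n) z = x"
  using mono_or_antimono_funpow[OF mono_or_antimono_srs_map, of n r] assms
  by (metis antimonoD monoD order_antisym)

text \<open>Used with \<open>c = (- r) ^ n\<close>, whose sign alternates for positive
  \<open>r\<close>: scaling may reverse the order of the integers, hence the two
  alternatives.\<close>

lemma scaled_between:
  fixes c :: real and a b z :: int
  assumes "c * of_int a \<le> c * of_int z" "c * of_int z \<le> c * of_int b" "c \<noteq> 0"
  shows "a \<le> z \<and> z \<le> b \<or> b \<le> z \<and> z \<le> a"
  using assms by (cases "0 < c") (auto simp: mult_le_cancel_left)

lemma scaled_int_near:
  fixes c u :: real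
  assumes "c \<noteq> 0"
  obtains z :: int where "\<bar>c * of_int z - u\<bar> \<le> \<bar>c\<bar>"
proof
  have "\<bar>of_int \<lfloor>u / c\<rfloor> - u / c\<bar> \<le> 1" by linarith
  then have "\<bar>c * (of_int \<lfloor>u / c\<rfloor> - u / c)\<bar> \<le> \<bar>c\<bar>"
    by (simp only: abs_mult mult_left_le abs_ge_zero)
  then show "\<bar>c * of_int \<lfloor>u / c\<rfloor> - u\<bar> \<le> \<bar>c\<bar>"
    using assms by (simp add: right_diff_distrib)
qed

section \<open>Surjectivity and error bounds for the iterates\<close>

lemma surj_srs_map:
  assumes "0 < \<bar>r\<bar>" "\<bar>r\<bar> < 1"
  shows "surj (srs_map r)"
proof -
  have "\<exists>z. srs_map r z = x" for x
  proof -
    \<comment> \<open>Multiples of \<open>r\<close> have gaps |r| < 1, so one of them falls into the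
      half-open unit interval from -x to -x + 1. Rounding \<open>- x / r\<close> finds it: upwards
      for positive \<open>r\<close>, downwards for negative \<open>r\<close>, where division
      reverses the order.\<close>
    obtain z :: int where "- of_int x \<le> r * of_int z" "r * of_int z < - of_int x + 1"
    proof (cases "0 < r")
      case True
      obtain z :: int where "- of_int x / r \<le> of_int z" "of_int z < - of_int x / r + 1"
        by (metis ceiling_correct diff_less_eq)
      then have "- of_int x \<le> r * of_int z" "r * of_int z < - of_int x + r"
        using True by (simp_all add: field_simps)
      then show ?thesis using that True assms(2) by simp
    next
      case False
      then have "r < 0" using assms by simp
      obtain z :: int where "of_int z \<le> - of_int x / r" "- of_int x / r < of_int z + 1"
        by (metis floor_correct of_int_1 of_int_add)
      then have "- of_int x \<le> r * of_int z" "r * of_int z < - of_int x - r"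
        using \<open>r < 0\<close> by (simp_all add: field_simps)
      then show ?thesis using that \<open>r < 0\<close> assms(2) by simp
    qed
    then have "\<lfloor>r * of_int z\<rfloor> = - x" by (intro floor_unique) simp_all
    then show ?thesis by (intro exI[of _ z]) (simp add: srs_map_def)
  qed
  then show ?thesis by (metis surj_def)
qed

text \<open>The errors satisfy e(k+1) \<le> |r| e(k) + 1, where 1 bounds the rounding in a single
  step. The constant is the fixed point of this recursion, hence uniform in \<open>k\<close> and
  \<open>w\<close>.\<close>

lemma srs_map_funpow_dist:
  assumes "\<bar>r\<bar> < 1"
  shows "\<bar>(- r) ^ k * of_int w - of_int ((srs_map r ^^ k) w)\<bar> \<le> 1 / (1 - \<bar>r\<bar>)"
proof (induction k)
  case 0
  then show ?case using assms by simp
next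
  case (Suc k)
  let ?v = "(srs_map r ^^ k) w"
  have "(- r) ^ Suc k * of_int w - of_int ((srs_map r ^^ Suc k) w)
      = (- r) * ((- r) ^ k * of_int w - of_int ?v) + (- r * of_int ?v - of_int (srs_map r ?v))"
    by (simp add: algebra_simps)
  then have "\<bar>(- r) ^ Suc k * of_int w - of_int ((srs_map r ^^ Suc k) w)\<bar>
      \<le> \<bar>r\<bar> * \<bar>(- r) ^ k * of_int w - of_int ?v\<bar> + \<bar>- r * of_int ?v - of_int (srs_map r ?v)\<bar>"
    by (metis abs_minus_cancel abs_mult abs_triangle_ineq)
  also have "\<dots> \<le> \<bar>r\<bar> * (1 / (1 - \<bar>r\<bar>)) + 1"
  proof (intro add_mono mult_left_mono Suc.IH)
    show "\<bar>- r * of_int ?v - of_int (srs_map r ?v)\<bar> \<le> 1"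
      unfolding srs_map_def by simp linarith
  qed simp
  also have "\<dots> = 1 / (1 - \<bar>r\<bar>)" using assms by (simp add: field_simps)
  finally show ?case .
qed

lemma srs_map_funpow_dist_shift:
  assumes "\<bar>r\<bar> < 1"
  shows "\<bar>(- r) ^ (n + k) * of_int w - (- r) ^ n * of_int ((srs_map r ^^ k) w)\<bar>
    \<le> \<bar>r\<bar> ^ n / (1 - \<bar>r\<bar>)"
proof -
  have "\<bar>(- r) ^ (n + k) * of_int w - (- r) ^ n * of_int ((srs_map r ^^ k) w)\<bar>
      = \<bar>r\<bar> ^ n * \<bar>(- r) ^ k * of_int w - of_int ((srs_map r ^^ k) w)\<bar>"
    by (simp add: power_add mult.assoc flip: right_diff_distrib)
       (simp add: abs_mult power_abs)
  also have "\<dots> \<le> \<bar>r\<bar> ^ n * (1 / (1 - \<bar>r\<bar>))"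
    by (intro mult_left_mono srs_map_funpow_dist assms) simp
  finally show ?thesis by simp
qed

section \<open>Criteria for membership in a tile\<close>

lemma srs_tile_iff:
  "t \<in> srs_tile r x \<longleftrightarrow>
    (\<forall>e>0. \<forall>\<^sub>F n in sequentially. \<exists>z. (srs_map r ^^ n) z = x \<and> \<bar>(- r) ^ n * of_int z - t\<bar> < e)"
    (is "_ \<longleftrightarrow> ?R")
proof
  assume t: "t \<in> srs_tile r x"
  show ?R
  proof (intro allI impI)
    fix e :: real
    assume "0 < e"
    then have "open (ball t e) \<and> t \<in> ball t e" by simp
    then have "\<forall>\<^sub>F n in sequentially.
        ball t e \<inter> (\<lambda>z. (- r) ^ n * of_int z) ` ((srs_map r ^^ n) -` {x}) \<noteq> {}"
      using t unfolding srs_tile_def lower_hausdorff_limit_def by blast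
    then show "\<forall>\<^sub>F n in sequentially.
        \<exists>z. (srs_map r ^^ n) z = x \<and> \<bar>(- r) ^ n * of_int z - t\<bar> < e"
      by (rule eventually_mono) (auto simp: dist_real_def abs_minus_commute)
  qed
next
  assume R: ?R
  show "t \<in> srs_tile r x"
    unfolding srs_tile_def lower_hausdorff_limit_def
  proof (intro CollectI allI impI)
    fix U :: "real set"
    assume "open U \<and> t \<in> U"
    then obtain e where e: "0 < e" "ball t e \<subseteq> U"
      by (meson open_contains_ball)
    have "\<forall>\<^sub>F n in sequentially.
        \<exists>z. (srs_map r ^^ n) z = x \<and> \<bar>(- r) ^ n * of_int z - t\<bar> < e"
      using R e(1) by blast
    then show "\<forall>\<^sub>F n in sequentially.
        U \<inter> (\<lambda>z. (- r) ^ n * of_int z) ` ((srs_map r ^^ n) -` {x}) \<noteq> {}"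
    proof (rule eventually_mono)
      fix n
      assume "\<exists>z. (srs_map r ^^ n) z = x \<and> \<bar>(- r) ^ n * of_int z - t\<bar> < e"
      then obtain z where z: "(srs_map r ^^ n) z = x" "\<bar>(- r) ^ n * of_int z - t\<bar> < e"
        by blast
      then have "(- r) ^ n * of_int z \<in> U"
        using e(2) by (auto simp: dist_real_def abs_minus_commute)
      then show "U \<inter> (\<lambda>z. (- r) ^ n * of_int z) ` ((srs_map r ^^ n) -` {x}) \<noteq> {}"
        using z(1) by blast
    qed
  qed
qed

lemma eventually_power_abs_less:
  fixes r :: real
  assumes "\<bar>r\<bar> < 1" "0 < e"
  shows "\<forall>\<^sub>F n in sequentially. C * \<bar>r\<bar> ^ n < e"
proof -
  have "(\<lambda>n. C * \<bar>r\<bar> ^ n) \<longlonglongrightarrow> C * 0"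
    using assms by (intro tendsto_mult_left LIMSEQ_power_zero) simp
  then show ?thesis using assms by (simp add: order_tendstoD)
qed

text \<open>The limit asks for all large indices, yet one good index \<open>n\<close> serves every
  later \<open>m\<close>: lift its point through the surjective iterate of order m - n, which moves
  the rescaled point only by a multiple of |r|^n.\<close>

lemma srs_tile_memI_frequently:
  assumes "0 < \<bar>r\<bar>" "\<bar>r\<bar> < 1"
    and freq: "\<exists>\<^sub>F n in sequentially.
      \<exists>z. (srs_map r ^^ n) z = x \<and> \<bar>(- r) ^ n * of_int z - t\<bar> \<le> D * \<bar>r\<bar> ^ n"
  shows "t \<in> srs_tile r x"
  unfolding srs_tile_iff
proof (intro allI impI)
  fix e :: real
  assume "0 < e"
  let ?C = "1 / (1 - \<bar>r\<bar>)"
  \<comment> \<open>The summand \<open>?C\<close> pays for passing from level \<open>n\<close> to a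
    later level, \<open>D\<close> for the distance to \<open>t\<close> at level
    \<open>n\<close>.\<close>
  have "\<exists>\<^sub>F n in sequentially.
      (\<exists>z. (srs_map r ^^ n) z = x \<and> \<bar>(- r) ^ n * of_int z - t\<bar> \<le> D * \<bar>r\<bar> ^ n) \<and>
      (?C + D) * \<bar>r\<bar> ^ n < e"
    using freq eventually_power_abs_less[OF assms(2) \<open>0 < e\<close>]
    by (rule frequently_eventually_frequently)
  then obtain n z where z: "(srs_map r ^^ n) z = x"
      "\<bar>(- r) ^ n * of_int z - t\<bar> \<le> D * \<bar>r\<bar> ^ n" "(?C + D) * \<bar>r\<bar> ^ n < e"
    using frequently_ex by blast
  have "\<exists>w. (srs_map r ^^ m) w = x \<and> \<bar>(- r) ^ m * of_int w - t\<bar> < e" if le: "n \<le> m" for m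
  proof -
    obtain k where m: "m = n + k" using le by (metis le_Suc_ex)
    have "surj (srs_map r ^^ k)" using surj_srs_map[OF assms(1,2)] by simp
    then obtain w where w: "(srs_map r ^^ k) w = z" by (metis surjD)
    have "\<bar>(- r) ^ m * of_int w - (- r) ^ n * of_int z\<bar> \<le> \<bar>r\<bar> ^ n / (1 - \<bar>r\<bar>)"
      using srs_map_funpow_dist_shift[OF assms(2), of n k w] by (simp only: w m)
    then have "\<bar>(- r) ^ m * of_int w - t\<bar> < e"
      using z(2,3) by (simp add: distrib_right)
    moreover have "(srs_map r ^^ m) w = x" using w z(1) by (simp add: m funpow_add)
    ultimately show ?thesis by blast
  qed
  then show "\<forall>\<^sub>F m in sequentially.
      \<exists>w. (srs_map r ^^ m) w = x \<and> \<bar>(- r) ^ m * of_int w - t\<bar> < e"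
    unfolding eventually_sequentially by blast
qed

section \<open>Existence of points: nonempty tiles and covering\<close>

lemma srs_tile_nonempty:
  assumes "0 < \<bar>r\<bar>" "\<bar>r\<bar> < 1"
  shows "srs_tile r x \<noteq> {}"
proof -
  \<comment> \<open>By surjectivity \<open>inv\<close> is a right inverse, so \<open>z\<close> is a
    backward orbit starting at \<open>x\<close>; its rescaling \<open>y\<close> turns out to be
    Cauchy.\<close>
  define z where "z n = (inv (srs_map r) ^^ n) x" for n
  define y where "y n = (- r) ^ n * of_int (z n)" for n
  let ?C = "1 / (1 - \<bar>r\<bar>)"
  have step: "srs_map r (z (Suc n)) = z n" for n
    using surj_srs_map[OF assms] by (simp add: z_def surj_f_inv_f)
  have shift: "(srs_map r ^^ k) (z (n + k)) = z n" for n k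
    by (induction k) (simp_all add: funpow_Suc_right step del: funpow.simps(2))
  have bound: "\<bar>y m - y n\<bar> \<le> ?C * \<bar>r\<bar> ^ n" if le: "n \<le> m" for m n
  proof -
    obtain k where "m = n + k" using le by (metis le_Suc_ex)
    then show ?thesis
      using srs_map_funpow_dist_shift[OF assms(2), of n k "z m"] by (simp add: y_def shift)
  qed
  have "Cauchy y"
    unfolding Cauchy_altdef2
  proof (intro allI impI)
    fix e :: real
    assume "0 < e"
    then obtain N where "?C * \<bar>r\<bar> ^ N < e"
      using eventually_happens'[OF sequentially_bot eventually_power_abs_less[OF assms(2)]] by metis
    then have "\<forall>m\<ge>N. dist (y m) (y N) < e"
      using bound by (metis dist_real_def order_le_less_trans)
    then show "\<exists>N. \<forall>m\<ge>N. dist (y m) (y N) < e" ..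
  qed
  then obtain t where t: "y \<longlonglongrightarrow> t"
    by (meson Cauchy_convergent convergent_def)
  \<comment> \<open>Letting \<open>m\<close> tend to infinity in \<open>bound\<close> keeps the
    geometric rate.\<close>
  have "\<bar>y n - t\<bar> \<le> ?C * \<bar>r\<bar> ^ n" for n
  proof (rule tendsto_upperbound)
    show "(\<lambda>m. \<bar>y n - y m\<bar>) \<longlonglongrightarrow> \<bar>y n - t\<bar>" by (intro tendsto_intros t)
    show "\<forall>\<^sub>F m in sequentially. \<bar>y n - y m\<bar> \<le> ?C * \<bar>r\<bar> ^ n"
      using eventually_ge_at_top[of n] by eventually_elim (metis bound abs_minus_commute)
  qed simp
  moreover have "(srs_map r ^^ n) (z n) = x" for n
    using shift[of n 0] by (simp add: z_def)
  ultimately have "\<exists>z. (srs_map r ^^ n) z = x \<and> \<bar>(- r) ^ n * of_int z - t\<bar> \<le> ?C * \<bar>r\<bar> ^ n" for n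
    unfolding y_def by blast
  then have "t \<in> srs_tile r x"
    by (intro srs_tile_memI_frequently[OF assms, where D = ?C] eventually_frequently
        always_eventually) simp_all
  then show ?thesis by blast
qed

lemma srs_tile_cover:
  assumes "0 < \<bar>r\<bar>" "\<bar>r\<bar> < 1"
  shows "(\<Union>x. srs_tile r x) = UNIV"
proof -
  have "\<exists>x. t \<in> srs_tile r x" for t
  proof -
    let ?C = "1 / (1 - \<bar>r\<bar>)"
    have "\<exists>z::int. \<bar>(- r) ^ n * of_int z - t\<bar> \<le> \<bar>r\<bar> ^ n" for n
      using scaled_int_near[of "(- r) ^ n" t] assms(1) by (auto simp: power_abs)
    then obtain z :: "nat \<Rightarrow> int" where z: "\<bar>(- r) ^ n * of_int (z n) - t\<bar> \<le> \<bar>r\<bar> ^ n" for n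
      by metis
    define x where "x n = (srs_map r ^^ n) (z n)" for n
    \<comment> \<open>The rescaled \<open>z n\<close> is within |r|^n \<le> 1 of \<open>t\<close>,
      and \<open>?C\<close> bounds its distance to \<open>x n\<close>.\<close>
    have x_bound: "\<bar>real_of_int (x n)\<bar> \<le> \<bar>t\<bar> + 1 + ?C" for n
    proof -
      have "\<bar>r\<bar> ^ n \<le> 1" using assms by (simp add: power_le_one)
      then show ?thesis
        using z[of n] srs_map_funpow_dist[OF assms(2), of n "z n"] unfolding x_def by linarith
    qed
    let ?B = "{- \<lceil>\<bar>t\<bar> + 1 + ?C\<rceil>..\<lceil>\<bar>t\<bar> + 1 + ?C\<rceil>}"
    have "x n \<in> ?B" for n
      using x_bound[of n] by simp linarith
    then have "finite (range x)" by (meson finite_atLeastAtMost_int finite_subset image_subsetI)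
    then obtain n0 where "infinite {n. x n = x n0}"
      using pigeonhole_infinite[of "UNIV :: nat set" x] by auto
    \<comment> \<open>On the naturals the cofinite filter is \<open>sequentially\<close>, so an
      infinite index set means frequently.\<close>
    then have "\<exists>\<^sub>F n in sequentially. x n = x n0"
      using frequently_cofinite[of "\<lambda>n. x n = x n0"] by (simp add: cofinite_eq_sequentially)
    then have "\<exists>\<^sub>F n in sequentially.
        \<exists>z. (srs_map r ^^ n) z = x n0 \<and> \<bar>(- r) ^ n * of_int z - t\<bar> \<le> 1 * \<bar>r\<bar> ^ n"
      by (rule frequently_elim1) (use z x_def in auto)
    then show ?thesis using srs_tile_memI_frequently[OF assms] by blast
  qed
  then show ?thesis by auto
qed

section \<open>Interval property and overlaps of tiles\<close>

lemma srs_tile_eventually_preimage: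
  assumes "0 < \<bar>r\<bar>" and "s \<in> srs_tile r x" "t \<in> srs_tile r x" "s < a" "b < t"
  shows "\<forall>\<^sub>F n in sequentially. \<forall>z. a \<le> (- r) ^ n * of_int z \<and> (- r) ^ n * of_int z \<le> b \<longrightarrow>
    (srs_map r ^^ n) z = x"
proof -
  \<comment> \<open>The tolerances \<open>a - s\<close> and \<open>t - b\<close> place one rescaled
    preimage of \<open>x\<close> below \<open>a\<close> and another above \<open>b\<close>; whatever
    lies from \<open>a\<close> to \<open>b\<close> is trapped between them.\<close>
  have "\<forall>\<^sub>F n in sequentially. \<exists>z. (srs_map r ^^ n) z = x \<and> \<bar>(- r) ^ n * of_int z - s\<bar> < a - s"
    using assms by (simp add: srs_tile_iff)
  moreover
  have "\<forall>\<^sub>F n in sequentially. \<exists>z. (srs_map r ^^ n) z = x \<and> \<bar>(- r) ^ n * of_int z - t\<bar> < t - b"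
    using assms by (simp add: srs_tile_iff)
  ultimately show ?thesis
  proof eventually_elim
    case (elim n)
    then obtain z1 z2 where z12:
        "(srs_map r ^^ n) z1 = x" "\<bar>(- r) ^ n * of_int z1 - s\<bar> < a - s"
        "(srs_map r ^^ n) z2 = x" "\<bar>(- r) ^ n * of_int z2 - t\<bar> < t - b"
      by blast
    show ?case
    proof (intro allI impI)
      fix z
      assume z: "a \<le> (- r) ^ n * of_int z \<and> (- r) ^ n * of_int z \<le> b"
      have "z1 \<le> z \<and> z \<le> z2 \<or> z2 \<le> z \<and> z \<le> z1"
        by (rule scaled_between[of "(- r) ^ n"]) (use z z12 assms(1) in auto)
      then show "(srs_map r ^^ n) z = x"
        using srs_map_funpow_between z12 by blast
    qed
  qed
qed

lemma eventually_scaled_int_near: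
  fixes r u :: real
  assumes "0 < \<bar>r\<bar>" "\<bar>r\<bar> < 1" "0 < e"
  shows "\<forall>\<^sub>F n in sequentially. \<exists>z::int. \<bar>(- r) ^ n * of_int z - u\<bar> < e"
  using eventually_power_abs_less[OF assms(2,3), of 1]
proof eventually_elim
  case (elim n)
  obtain z :: int where "\<bar>(- r) ^ n * of_int z - u\<bar> \<le> \<bar>(- r) ^ n\<bar>"
    using scaled_int_near[of "(- r) ^ n" u] assms(1) by auto
  then show ?case using elim by (intro exI[of _ z]) (simp add: power_abs)
qed

lemma is_interval_srs_tile:
  assumes "0 < \<bar>r\<bar>" "\<bar>r\<bar> < 1"
  shows "is_interval (srs_tile r x)"
  unfolding is_interval_1
proof (intro ballI allI impI)
  fix s t u
  assume s: "s \<in> srs_tile r x" and t: "t \<in> srs_tile r x" and "s \<le> u \<and> u \<le> t"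
  show "u \<in> srs_tile r x"
  proof (cases "u = s \<or> u = t")
    case True
    then show ?thesis using s t by blast
  next
    case False
    then have "s < u" "u < t" using \<open>s \<le> u \<and> u \<le> t\<close> by auto
    show ?thesis
      unfolding srs_tile_iff
    proof (intro allI impI)
      fix e :: real
      assume "0 < e"
      \<comment> \<open>Half the distances to \<open>s\<close> and \<open>t\<close> keep the closed
        window around \<open>u\<close> strictly between them, as the trapping lemma requires; this
        is why the endpoints were split off.\<close>
      define d where "d = min e (min ((u - s) / 2) ((t - u) / 2))"
      have d: "0 < d" "d \<le> e" "s < u - d" "u + d < t"
        using \<open>0 < e\<close> \<open>s < u\<close> \<open>u < t\<close> by (auto simp: d_def min_def field_simps)
      show "\<forall>\<^sub>F n in sequentially.
          \<exists>z. (srs_map r ^^ n) z = x \<and> \<bar>(- r) ^ n * of_int z - u\<bar> < e"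
        using srs_tile_eventually_preimage[OF assms(1) s t d(3,4)]
          eventually_scaled_int_near[OF assms d(1), of u]
      proof eventually_elim
        case (elim n)
        then obtain z where z: "\<bar>(- r) ^ n * of_int z - u\<bar> < d" by blast
        then have "(srs_map r ^^ n) z = x" using elim(1) by (simp add: abs_less_iff)
        then show ?case using z d(2) by (intro exI[of _ z]) simp
      qed
    qed
  qed
qed

lemma srs_tile_inter_unique:
  assumes "0 < \<bar>r\<bar>" "\<bar>r\<bar> < 1" "x \<noteq> x'"
    and s: "s \<in> srs_tile r x" "s \<in> srs_tile r x'"
    and t: "t \<in> srs_tile r x" "t \<in> srs_tile r x'"
  shows "\<not> s < t"
proof
  assume "s < t"
  define u d where "u = (s + t) / 2" and "d = (t - s) / 4"
  have d: "0 < d" "s < u - d" "u + d < t"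
    using \<open>s < t\<close> by (auto simp: u_def d_def field_simps)
  \<comment> \<open>An integer whose multiple is near the midpoint \<open>u\<close> would be sent by
    the same iterate to both \<open>x\<close> and \<open>x'\<close>.\<close>
  have "\<forall>\<^sub>F n in sequentially. False"
    using srs_tile_eventually_preimage[OF assms(1) s(1) t(1) d(2,3)]
      srs_tile_eventually_preimage[OF assms(1) s(2) t(2) d(2,3)]
      eventually_scaled_int_near[OF assms(1,2) d(1), of u]
  proof eventually_elim
    case (elim n)
    then obtain z where "\<bar>(- r) ^ n * of_int z - u\<bar> < d" by blast
    then have "u - d \<le> (- r) ^ n * of_int z \<and> (- r) ^ n * of_int z \<le> u + d" by linarith
    then show ?case using elim(1,2) assms(3) by blast
  qed
  then show False by simp
qed

text \<open>Finiteness is recorded because \<open>card\<close> of an infinite set is 0, so the bound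
  on \<open>card\<close> alone would not exclude a common interval.\<close>

lemma srs_tile_inter_card:
  assumes "0 < \<bar>r\<bar>" "\<bar>r\<bar> < 1" "x \<noteq> x'"
  shows "finite (srs_tile r x \<inter> srs_tile r x') \<and> card (srs_tile r x \<inter> srs_tile r x') \<le> 1"
proof -
  have "s = t" if "s \<in> srs_tile r x \<inter> srs_tile r x'" "t \<in> srs_tile r x \<inter> srs_tile r x'" for s t
    using srs_tile_inter_unique[OF assms] that by (metis IntE linorder_neqE)
  then obtain s where s: "srs_tile r x \<inter> srs_tile r x' \<subseteq> {s}" by blast
  then have "card (srs_tile r x \<inter> srs_tile r x') \<le> card {s}" by (intro card_mono) simp_all
  then show ?thesis using finite_subset[OF s] by simp
qed

theorem theorem4p9:
  fixes r :: real
  assumes "0 < \<bar>r\<bar>" and "\<bar>r\<bar> < 1"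
  shows "(\<forall>x. is_interval (srs_tile r x) \<and> srs_tile r x \<noteq> {}) \<and>
         (\<Union>x. srs_tile r x) = UNIV \<and>
         (\<forall>x x'. x \<noteq> x' \<longrightarrow>
            finite (srs_tile r x \<inter> srs_tile r x') \<and>
            card (srs_tile r x \<inter> srs_tile r x') \<le> 1)"
  using is_interval_srs_tile[OF assms] srs_tile_nonempty[OF assms] srs_tile_cover[OF assms]
    srs_tile_inter_card[OF assms]
  by (intro conjI allI impI) simp_all

end
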